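(* Let $k\ge 1$. The number of unordered positions $\{a,b,a+b\}$, where $\{a,b\}$ is an unordered pair of positive integers with $a\oplus b\oplus(a+b)=0$, in which all three piles have at most $k$ binary digits, equals $\frac{3^k}{2}-2^k+\frac12$.
   Context: $\oplus$ denotes bitwise exclusive-or. *)

theory Defs
  imports "HOL-Library.Multiset" "HOL-Library.Log_Nat"
begin

unbundle bit_operations_syntax

text \<open>
  A position is the multiset of its three pile sizes. The number of binary digits of a
  pile \<^term>\<open>p\<close> is \<^term>\<open>floorlog 2 p\<close>.
\<close>

definition sum_positions :: "nat \<Rightarrow> nat multiset set" where
  "sum_positions k =
     {{#a, b, a + b#} | a b.
        a > 0 \<and> b > 0 \<and> a XOR b XOR (a + b) = 0 \<and>
        (\<forall>p \<in># {#a, b, a + b#}. floorlog 2 p \<le> k)}"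

end

theory Submission
  imports Defs
begin

text \<open>
  Since a + b = (a XOR b) + 2 (a AND b), the condition says that a and b have disjoint binary
  supports. Choosing for each of the k digits whether it belongs to a, to b or to neither gives
  3^k ordered pairs, of which 2 * 2^k - 1 have a zero entry. The remaining pairs have
  distinct entries, so each position arises from exactly two of them.
\<close>

lemma plus_and_or_nat:
  fixes a b :: nat
  shows "(a AND b) + (a OR b) = a + b"
  using plus_and_or[of "int a" "int b"] by (simp flip: of_nat_and_eq of_nat_or_eq of_nat_add)

lemma xor_plus_and_eq_or:
  fixes a b :: "'a :: semiring_bit_operations"
  shows "(a XOR b) + (a AND b) = a OR b"
proof -
  have "(a XOR b) AND (a AND b) = 0"
    by (auto simp: bit_eq_iff bit_simps)
  then have "(a XOR b) + (a AND b) = (a XOR b) OR (a AND b)"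
    by (rule disjunctive_add_eq_or)
  also have "\<dots> = a OR b"
    by (auto simp: bit_eq_iff bit_simps)
  finally show ?thesis .
qed

lemma xor_eq_0_iff:
  fixes a b :: "'a :: semiring_bit_operations"
  shows "a XOR b = 0 \<longleftrightarrow> a = b"
  by (auto simp: bit_eq_iff bit_simps)

lemma xor_plus_twice_and_nat:
  fixes a b :: nat
  shows "(a XOR b) + 2 * (a AND b) = a + b"
  using plus_and_or_nat[of a b] xor_plus_and_eq_or[of a b] by simp

lemma xor_xor_sum_eq_0_iff:
  fixes a b :: nat
  shows "a XOR b XOR (a + b) = 0 \<longleftrightarrow> a AND b = 0"
proof -
  have "a XOR b XOR (a + b) = 0 \<longleftrightarrow> a XOR b = a + b"
    by (simp add: xor_eq_0_iff flip: xor.assoc)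
  also have "\<dots> \<longleftrightarrow> a AND b = 0"
    using xor_plus_twice_and_nat[of a b] by linarith
  finally show ?thesis .
qed

lemma or_less_exp:
  fixes a b :: nat
  assumes "a < 2 ^ n" and "b < 2 ^ n"
  shows "a OR b < 2 ^ n"
  using assms by (simp flip: take_bit_nat_eq_self_iff)

lemma drop_bit_less_exp:
  fixes a :: nat
  assumes "a < 2 ^ (m + n)"
  shows "drop_bit n a < 2 ^ m"
  using assms by (simp add: drop_bit_eq_div less_mult_imp_div_less power_add)

definition disjoint_pairs :: "nat \<Rightarrow> (nat \<times> nat) set" where
  "disjoint_pairs k = {(a, b). a < 2 ^ k \<and> b < 2 ^ k \<and> a AND b = 0}"

lemma disjoint_pairs_iff_sum_less:
  "(a, b) \<in> disjoint_pairs k \<longleftrightarrow> a AND b = 0 \<and> a + b < 2 ^ k"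
proof (cases "a AND b = 0")
  case True
  then have "a < 2 ^ k \<and> b < 2 ^ k \<longleftrightarrow> a + b < 2 ^ k"
    using or_less_exp[of a k b] disjunctive_add_eq_or[of a b] by linarith
  with True show ?thesis
    by (simp add: disjoint_pairs_def)
qed (simp add: disjoint_pairs_def)

lemma finite_disjoint_pairs: "finite (disjoint_pairs k)"
  by (rule finite_subset[of _ "{..<2 ^ k} \<times> {..<2 ^ k}"]) (auto simp: disjoint_pairs_def)

lemma disjoint_pairs_0: "disjoint_pairs 0 = {(0, 0)}"
  by (auto simp: disjoint_pairs_def)

lemma disjoint_pairs_1: "disjoint_pairs 1 = {(0, 0), (1, 0), (0, 1)}"
  by (auto simp: disjoint_pairs_def less_2_cases_iff)

definition append_bits :: "nat \<Rightarrow> 'a \<Rightarrow> 'a \<Rightarrow> 'a :: semiring_bit_operations" where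
  "append_bits n a c = push_bit n a OR take_bit n c"

lemma drop_bit_append_bits:
  fixes a c :: "'a :: linordered_euclidean_semiring_bit_operations"
  shows "drop_bit n (append_bits n a c) = a"
  by (auto simp: append_bits_def bit_eq_iff bit_simps)

lemma take_bit_append_bits: "take_bit n (append_bits n a c) = take_bit n c"
  by (auto simp: append_bits_def bit_eq_iff bit_simps)

lemma append_bits_drop_take: "append_bits n (drop_bit n x) (take_bit n x) = x"
  by (auto simp: append_bits_def bit_eq_iff bit_simps)

lemma append_bits_and:
  "append_bits n a c AND append_bits n b d = append_bits n (a AND b) (c AND d)"
  by (auto simp: append_bits_def bit_eq_iff bit_simps)

lemma append_bits_0: "append_bits n 0 0 = 0"
  by (simp add: append_bits_def)

lemma append_bits_less_exp:
  fixes a c :: nat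
  assumes "a < 2 ^ m"
  shows "append_bits n a c < 2 ^ (m + n)"
proof -
  have "push_bit n a < 2 ^ (m + n)"
    using assms by (simp add: push_bit_eq_mult power_add)
  moreover have "take_bit n c < 2 ^ (m + n)"
    by (rule less_le_trans[OF take_bit_nat_less_exp]) simp
  ultimately show ?thesis
    unfolding append_bits_def by (rule or_less_exp)
qed

lemma bij_betw_append_disjoint_pairs:
  "bij_betw (\<lambda>((a, b), (c, d)). (append_bits n a c, append_bits n b d))
     (disjoint_pairs m \<times> disjoint_pairs n) (disjoint_pairs (m + n))"
  (is "bij_betw ?append (?Dm \<times> ?Dn) ?D")
proof (rule bij_betw_byWitness)
  let ?split = "\<lambda>(a, b). ((drop_bit n a, drop_bit n b), (take_bit n a, take_bit n b))"
  show "\<forall>p \<in> ?Dm \<times> ?Dn. ?split (?append p) = p"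
    by (auto simp: disjoint_pairs_def drop_bit_append_bits take_bit_append_bits take_bit_nat_eq_self)
  show "\<forall>p \<in> ?D. ?append (?split p) = p"
    by (simp add: append_bits_drop_take split: prod.split)
  show "?append ` (?Dm \<times> ?Dn) \<subseteq> ?D"
    by (auto simp: disjoint_pairs_def append_bits_less_exp append_bits_and append_bits_0)
  show "?split ` ?D \<subseteq> ?Dm \<times> ?Dn"
    by (auto simp: disjoint_pairs_def drop_bit_less_exp simp flip: drop_bit_and take_bit_and)
qed

lemma card_disjoint_pairs: "card (disjoint_pairs k) = 3 ^ k"
proof (induction k)
  case 0
  show ?case
    by (simp add: disjoint_pairs_0)
next
  case (Suc k)
  have "card (disjoint_pairs (Suc k)) = card (disjoint_pairs k \<times> disjoint_pairs 1)"
    using bij_betw_same_card[OF bij_betw_append_disjoint_pairs[of 1 k]] by simp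
  also have "\<dots> = 3 ^ k * 3"
    by (simp add: card_cartesian_product Suc disjoint_pairs_1 del: One_nat_def)
  finally show ?case
    by simp
qed

definition positive_disjoint_pairs :: "nat \<Rightarrow> (nat \<times> nat) set" where
  "positive_disjoint_pairs k = {(a, b) \<in> disjoint_pairs k. 0 < a \<and> 0 < b}"

lemma finite_positive_disjoint_pairs: "finite (positive_disjoint_pairs k)"
  by (rule finite_subset[OF _ finite_disjoint_pairs]) (auto simp: positive_disjoint_pairs_def)

lemma swap_mem_positive_disjoint_pairs:
  "(a, b) \<in> positive_disjoint_pairs k \<Longrightarrow> (b, a) \<in> positive_disjoint_pairs k"
  by (simp add: positive_disjoint_pairs_def disjoint_pairs_def and.commute)

lemma positive_disjoint_pairs_neq: "(a, b) \<in> positive_disjoint_pairs k \<Longrightarrow> a \<noteq> b"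
  by (auto simp: positive_disjoint_pairs_def disjoint_pairs_def)

lemma card_positive_disjoint_pairs:
  "card (positive_disjoint_pairs k) + 2 * 2 ^ k = 3 ^ k + 1"
proof -
  let ?Left = "{0 :: nat} \<times> {..<2 ^ k :: nat}"
    and ?Right = "{0<..<2 ^ k :: nat} \<times> {0 :: nat}"
  have "disjoint_pairs k = positive_disjoint_pairs k \<union> (?Left \<union> ?Right)"
    by (auto simp: positive_disjoint_pairs_def disjoint_pairs_def)
  then have "3 ^ k = card (positive_disjoint_pairs k \<union> (?Left \<union> ?Right))"
    by (simp flip: card_disjoint_pairs)
  also have "\<dots> = card (positive_disjoint_pairs k) + card (?Left \<union> ?Right)"
  proof (rule card_Un_disjoint[OF finite_positive_disjoint_pairs])
    show "positive_disjoint_pairs k \<inter> (?Left \<union> ?Right) = {}"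
      by (auto simp: positive_disjoint_pairs_def)
  qed simp
  also have "card (?Left \<union> ?Right) = card ?Left + card ?Right"
    by (rule card_Un_disjoint) auto
  also have "card ?Left + card ?Right = 2 ^ k + (2 ^ k - 1)"
    by (simp add: card_cartesian_product)
  finally show ?thesis
    by (simp add: Suc_leI)
qed

lemma card_eq_mult_card_image:
  assumes "finite A" and card_fibre: "\<And>x. x \<in> A \<Longrightarrow> card {y \<in> A. f y = f x} = n"
  shows "card A = n * card (f ` A)"
proof -
  have "card A = (\<Sum>z\<in>f ` A. card {y \<in> A. f y = z})"
    unfolding card_eq_sum using \<open>finite A\<close> by (rule sum.image_gen)
  also have "\<dots> = (\<Sum>z\<in>f ` A. n)"
    by (rule sum.cong) (auto simp: card_fibre)
  also have "\<dots> = n * card (f ` A)"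
    by simp
  finally show ?thesis .
qed

lemma double_eq_iff:
  fixes a b :: "'a :: {linorder, ordered_cancel_comm_monoid_add}"
  shows "a + a = b + b \<longleftrightarrow> a = b"
  by (metis add_strict_mono less_irrefl neq_iff)

lemma sum_position_eq_iff:
  fixes a b c d :: "'a :: {linorder, ordered_cancel_comm_monoid_add}"
  shows "{#a, b, a + b#} = {#c, d, c + d#} \<longleftrightarrow> (a, b) = (c, d) \<or> (a, b) = (d, c)"
proof
  assume eq: "{#a, b, a + b#} = {#c, d, c + d#}"
  have "(a + b) + (a + b) = (c + d) + (c + d)"
    using arg_cong[OF eq, of sum_mset] by (simp add: add.assoc)
  then have "a + b = c + d"
    by (simp only: double_eq_iff)
  with eq have "{#a, b#} = {#c, d#}"
    by (simp add: add_mset_commute)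
  then show "(a, b) = (c, d) \<or> (a, b) = (d, c)"
    by (auto simp: add_eq_conv_ex)
qed (auto simp: add_mset_commute add.commute)

lemma sum_positions_eq_image:
  "sum_positions k = (\<lambda>(a, b). {#a, b, a + b#}) ` positive_disjoint_pairs k"
proof -
  have "a > 0 \<and> b > 0 \<and> a XOR b XOR (a + b) = 0 \<and>
      (\<forall>p \<in># {#a, b, a + b#}. floorlog 2 p \<le> k) \<longleftrightarrow> (a, b) \<in> positive_disjoint_pairs k" for a b
    by (auto simp: xor_xor_sum_eq_0_iff floorlog_le_iff positive_disjoint_pairs_def
        disjoint_pairs_iff_sum_less)
  then show ?thesis
    by (auto simp: sum_positions_def)
qed

lemma card_positive_disjoint_pairs_eq_twice:
  "card (positive_disjoint_pairs k) = 2 * card (sum_positions k)"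
  unfolding sum_positions_eq_image
proof (rule card_eq_mult_card_image[OF finite_positive_disjoint_pairs])
  let ?position = "\<lambda>(a, b). {#a, b, a + b#}"
  fix p assume "p \<in> positive_disjoint_pairs k"
  then obtain a b where p: "p = (a, b)" and ab: "(a, b) \<in> positive_disjoint_pairs k"
    by (cases p) simp
  have "{q \<in> positive_disjoint_pairs k. ?position q = ?position p} = {(a, b), (b, a)}"
    using ab swap_mem_positive_disjoint_pairs[OF ab] by (auto simp: p sum_position_eq_iff)
  then show "card {q \<in> positive_disjoint_pairs k. ?position q = ?position p} = 2"
    using positive_disjoint_pairs_neq[OF ab] by simp
qed

theorem theorem7p9:
  fixes k :: nat
  assumes "k \<ge> 1"
  shows "finite (sum_positions k) \<and>
    real (card (sum_positions k)) = 3 ^ k / 2 - 2 ^ k + 1 / 2"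
proof
  show "finite (sum_positions k)"
    by (simp add: sum_positions_eq_image finite_positive_disjoint_pairs)
  have "2 * card (sum_positions k) + 2 * 2 ^ k = 3 ^ k + 1"
    using card_positive_disjoint_pairs by (simp only: card_positive_disjoint_pairs_eq_twice)
  then have "real (2 * card (sum_positions k) + 2 * 2 ^ k) = real (3 ^ k + 1)"
    by (rule arg_cong)
  then show "real (card (sum_positions k)) = 3 ^ k / 2 - 2 ^ k + 1 / 2"
    by simp
qed

end
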